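(* Let $W$ be an invertible bilateral weighted shift, with weight sequence $(w_n)_{n \in \mathbb{Z}}$, on an infinite dimensional, separable complex Hilbert space $H$. If $r_1(W) < r_2^-(W)$, then its inverse $W^{-1}$ is a strongly compact operator.
   Context: A bilateral weighted shift on $H$ is a bounded linear operator $W$ with $We_n = w_n e_{n+1}$ for all $n \in \mathbb{Z}$, where $(e_n)_{n \in \mathbb{Z}}$ is an orthonormal basis of $H$ and $(w_n)_{n \in \mathbb{Z}}$ is a bounded sequence of nonzero complex numbers. For a bounded operator $T$ on $H$, its lower bound is $m(T) = \inf\{\|Tx\| : x \in H, \|x\| = 1\}$, and $r_1(T) = \sup_{n \geq 1} m(T^n)^{1/n} = \lim_{n \to \infty} m(T^n)^{1/n}$. Set $r_2^-(W) = \liminf_{n \to \infty} |w_{-1} w_{-2} \cdots w_{-n}|^{1/n}$. Let $\mathcal{B}(H)$ be the algebra of bounded linear operators on $H$. A subalgebra $\mathcal{R} \subseteq \mathcal{B}(H)$ is strongly compact if its unit ball $\{R \in \mathcal{R} : \|R\| \leq 1\}$ is precompact (i.e., has compact closure) in the strong operator topology of $\mathcal{B}(H)$. An operator $T \in \mathcal{B}(H)$ is strongly compact if the algebra with identity generated by $T$, namely $\{p(T) : p \text{ a complex polynomial}\}$, is strongly compact. *)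

theory Defs
  imports "HOL-Analysis.Analysis" "HOL-Computational_Algebra.Polynomial"
begin

section \<open>Complex Hilbert spaces\<close>

text \<open>
  The complex structure is added on top of \<^class>\<open>real_inner\<close>, so that norm and topology are those of
  the library.  The axiom \<open>inner_eq_Re_cinner\<close> says that the norm is the one induced by the complex
  inner product, which is linear in its first argument.
\<close>

class complex_inner = real_inner +
  fixes scaleC :: "complex \<Rightarrow> 'a \<Rightarrow> 'a" (infixr \<open>*\<^sub>C\<close> 75)
    and cinner :: "'a \<Rightarrow> 'a \<Rightarrow> complex"
  assumes scaleC_add_right: "a *\<^sub>C (x + y) = a *\<^sub>C x + a *\<^sub>C y"
    and scaleC_add_left: "(a + b) *\<^sub>C x = a *\<^sub>C x + b *\<^sub>C x"
    and scaleC_scaleC: "a *\<^sub>C b *\<^sub>C x = (a * b) *\<^sub>C x"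
    and scaleR_eq_scaleC: "r *\<^sub>R x = complex_of_real r *\<^sub>C x"
    and cinner_commute: "cinner x y = cnj (cinner y x)"
    and cinner_add_left: "cinner (x + y) z = cinner x z + cinner y z"
    and cinner_scaleC_left: "cinner (a *\<^sub>C x) y = a * cinner x y"
    and inner_eq_Re_cinner: "inner x y = Re (cinner x y)"

class complex_hilbert_space = complex_inner + complete_space

lemma scaleC_one: "1 *\<^sub>C x = (x :: 'a::complex_inner)"
  by (metis of_real_1 scaleR_eq_scaleC scaleR_one)

interpretation complex_vector: vector_space "scaleC :: complex \<Rightarrow> 'a \<Rightarrow> 'a::complex_inner"
  by unfold_locales (simp_all add: scaleC_add_right scaleC_add_left scaleC_scaleC scaleC_one)

lemma norm_scaleC: "norm (a *\<^sub>C x) = cmod a * norm (x :: 'a::complex_inner)"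
proof -
  have self: "cinner y y = complex_of_real ((norm y)\<^sup>2)" for y :: 'a
  proof (rule complex_eqI)
    have "Im (cinner y y) = - Im (cinner y y)"
      by (subst cinner_commute) simp
    then show "Im (cinner y y) = Im (complex_of_real ((norm y)\<^sup>2))"
      by simp
  qed (simp add: power2_norm_eq_inner inner_eq_Re_cinner)
  have "cinner (a *\<^sub>C x) (a *\<^sub>C x) = a * cnj (cinner (a *\<^sub>C x) x)"
    by (metis cinner_commute cinner_scaleC_left)
  also have "\<dots> = (a * cnj a) * cnj (cinner x x)"
    by (simp add: cinner_scaleC_left)
  also have "\<dots> = complex_of_real ((cmod a)\<^sup>2 * (norm x)\<^sup>2)"
    unfolding self complex_norm_square[symmetric] by simp
  finally have "(norm (a *\<^sub>C x))\<^sup>2 = (cmod a * norm x)\<^sup>2"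
    unfolding self of_real_eq_iff by (simp add: power_mult_distrib)
  then show ?thesis
    by simp
qed

definition infinite_dimensional :: "'a::complex_inner itself \<Rightarrow> bool" where
  "infinite_dimensional _ \<longleftrightarrow>
    \<not> (\<exists>B :: 'a set. finite B \<and> complex_vector.span B = UNIV)"

definition orthonormal_basis :: "('i \<Rightarrow> 'a::complex_inner) \<Rightarrow> bool" where
  "orthonormal_basis e \<longleftrightarrow>
    (\<forall>i j. cinner (e i) (e j) = (if i = j then 1 else 0)) \<and>
    closure (complex_vector.span (range e)) = UNIV"

section \<open>Bounded operators\<close>

text \<open>
  The type \<open>'a \<Rightarrow>\<^sub>L 'a\<close> consists of the bounded real-linear maps; the algebra of bounded operators on
  the complex space is the following subset.
\<close>

definition bounded_operators :: "('a::complex_inner \<Rightarrow>\<^sub>L 'a) set" where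
  "bounded_operators =
    {T. \<forall>c x. blinfun_apply T (c *\<^sub>C x) = c *\<^sub>C blinfun_apply T x}"

lift_definition op_scaleC ::
  "complex \<Rightarrow> ('a::complex_inner \<Rightarrow>\<^sub>L 'a) \<Rightarrow> ('a \<Rightarrow>\<^sub>L 'a)" is
  "\<lambda>c T x. c *\<^sub>C T x"
proof -
  fix c :: complex and T :: "'a \<Rightarrow> 'a"
  assume "bounded_linear T"
  moreover have "bounded_linear (\<lambda>x :: 'a. c *\<^sub>C x)"
    by (rule bounded_linear_intro[where K = "cmod c"])
      (simp_all only: scaleC_add_right scaleR_eq_scaleC scaleC_scaleC norm_scaleC mult.commute order_refl)
  ultimately show "bounded_linear (\<lambda>x. c *\<^sub>C T x)"
    by (rule bounded_linear_compose[rotated])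
qed

primrec op_power :: "('a::complex_inner \<Rightarrow>\<^sub>L 'a) \<Rightarrow> nat \<Rightarrow> ('a \<Rightarrow>\<^sub>L 'a)" where
  "op_power T 0 = id_blinfun"
| "op_power T (Suc n) = T o\<^sub>L op_power T n"

definition poly_op :: "complex poly \<Rightarrow> ('a::complex_inner \<Rightarrow>\<^sub>L 'a) \<Rightarrow> ('a \<Rightarrow>\<^sub>L 'a)" where
  "poly_op p T = (\<Sum>i\<le>degree p. op_scaleC (coeff p i) (op_power T i))"

definition invertible_op :: "('a::complex_inner \<Rightarrow>\<^sub>L 'a) \<Rightarrow> bool" where
  "invertible_op T \<longleftrightarrow>
    (\<exists>S\<in>bounded_operators. T o\<^sub>L S = id_blinfun \<and> S o\<^sub>L T = id_blinfun)"

definition inverse_op :: "('a::complex_inner \<Rightarrow>\<^sub>L 'a) \<Rightarrow> ('a \<Rightarrow>\<^sub>L 'a)" where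
  "inverse_op T =
    (THE S. S \<in> bounded_operators \<and> T o\<^sub>L S = id_blinfun \<and> S o\<^sub>L T = id_blinfun)"

lemma inverse_op:
  assumes "invertible_op T"
  shows "inverse_op T \<in> bounded_operators"
    and "T o\<^sub>L inverse_op T = id_blinfun" and "inverse_op T o\<^sub>L T = id_blinfun"
proof -
  let ?P = "\<lambda>S. S \<in> bounded_operators \<and> T o\<^sub>L S = id_blinfun \<and> S o\<^sub>L T = id_blinfun"
  have uniq: "S = S'" if "?P S" "?P S'" for S S'
  proof (rule blinfun_eqI)
    fix x
    have "T (S' x) = x" "S (T (S' x)) = S' x"
      using that by (metis blinfun_apply_blinfun_compose blinfun_apply_id_blinfun)+
    then show "S x = S' x"
      by simp
  qed
  obtain S where S: "?P S"
    using assms unfolding invertible_op_def by blast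
  have "?P (inverse_op T)"
    unfolding inverse_op_def by (rule theI[where P = ?P, OF S]) (rule uniq[OF _ S])
  then show "inverse_op T \<in> bounded_operators"
    and "T o\<^sub>L inverse_op T = id_blinfun" and "inverse_op T o\<^sub>L T = id_blinfun"
    by simp_all
qed

section \<open>Strong compactness\<close>

definition operator_subalgebra :: "('a::complex_inner \<Rightarrow>\<^sub>L 'a) set \<Rightarrow> bool" where
  "operator_subalgebra \<R> \<longleftrightarrow>
    \<R> \<subseteq> bounded_operators \<and> 0 \<in> \<R> \<and>
    (\<forall>S\<in>\<R>. \<forall>T\<in>\<R>. S + T \<in> \<R> \<and> S o\<^sub>L T \<in> \<R>) \<and>
    (\<forall>c. \<forall>T\<in>\<R>. op_scaleC c T \<in> \<R>)"

text \<open>Precompactness is taken inside the algebra of complex-linear bounded operators.\<close>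

definition strongly_compact_algebra :: "('a::complex_inner \<Rightarrow>\<^sub>L 'a) set \<Rightarrow> bool" where
  "strongly_compact_algebra \<R> \<longleftrightarrow> operator_subalgebra \<R> \<and>
    (let SOT = subtopology strong_operator_topology bounded_operators
     in compactin SOT (SOT closure_of {R\<in>\<R>. norm R \<le> 1}))"

definition generated_algebra :: "('a::complex_inner \<Rightarrow>\<^sub>L 'a) \<Rightarrow> ('a \<Rightarrow>\<^sub>L 'a) set" where
  "generated_algebra T = range (\<lambda>p. poly_op p T)"

definition strongly_compact_op :: "('a::complex_inner \<Rightarrow>\<^sub>L 'a) \<Rightarrow> bool" where
  "strongly_compact_op T \<longleftrightarrow> T \<in> bounded_operators \<and> strongly_compact_algebra (generated_algebra T)"

lemma poly_op_apply:
  "poly_op p T x = (\<Sum>i\<le>degree p. coeff p i *\<^sub>C op_power T i x)"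
  by (simp add: poly_op_def blinfun.sum_left op_scaleC.rep_eq)

lemma poly_op_apply_le:
  assumes "degree p \<le> n"
  shows "poly_op p T x = (\<Sum>i\<le>n. coeff p i *\<^sub>C op_power T i x)"
  unfolding poly_op_apply using assms
  by (intro sum.mono_neutral_left) (auto simp: coeff_eq_0)

lemma poly_op_0: "poly_op 0 T = 0"
  by (rule blinfun_eqI) (simp add: poly_op_apply)

lemma poly_op_1: "poly_op 1 T = id_blinfun"
  by (rule blinfun_eqI) (simp add: poly_op_apply)

lemma poly_op_add: "poly_op (p + q) T = poly_op p T + poly_op q T"
proof (rule blinfun_eqI)
  fix x
  let ?n = "max (degree p) (degree q)"
  have "degree (p + q) \<le> ?n" by (rule degree_add_le_max)
  then show "poly_op (p + q) T x = (poly_op p T + poly_op q T) x"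
    by (simp add: poly_op_apply_le[of _ ?n] blinfun.add_left
        complex_vector.scale_left_distrib sum.distrib)
qed

lemma poly_op_smult: "poly_op (smult c p) T = op_scaleC c (poly_op p T)"
proof (rule blinfun_eqI)
  fix x
  show "poly_op (smult c p) T x = op_scaleC c (poly_op p T) x"
    by (simp add: poly_op_apply_le[of _ "degree p"] degree_smult_le op_scaleC.rep_eq
        complex_vector.scale_sum_right)
qed

lemma bounded_operators_poly_op:
  assumes "T \<in> bounded_operators"
  shows "poly_op p T \<in> bounded_operators"
proof -
  have pow: "op_power T i (c *\<^sub>C x) = c *\<^sub>C op_power T i x" for i c x
    using assms by (induction i) (auto simp: bounded_operators_def)
  show ?thesis
    by (simp add: bounded_operators_def poly_op_apply pow complex_vector.scale_sum_right mult.commute)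
qed

lemma poly_op_mult:
  assumes "T \<in> bounded_operators"
  shows "poly_op (p * q) T = poly_op p T o\<^sub>L poly_op q T"
proof -
  have shift: "poly_op (pCons 0 r) T = T o\<^sub>L poly_op r T" for r
  proof (rule blinfun_eqI)
    fix x
    have "poly_op (pCons 0 r) T x =
        (\<Sum>i\<le>Suc (degree r). coeff (pCons 0 r) i *\<^sub>C op_power T i x)"
      by (rule poly_op_apply_le) (rule degree_pCons_le)
    also have "\<dots> = (\<Sum>i\<le>degree r. coeff r i *\<^sub>C T (op_power T i x))"
      by (simp add: sum.atMost_Suc_shift del: sum.atMost_Suc)
    also have "\<dots> = (T o\<^sub>L poly_op r T) x"
      using assms by (simp add: poly_op_apply blinfun.sum_right bounded_operators_def)
    finally show "poly_op (pCons 0 r) T x = (T o\<^sub>L poly_op r T) x" .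
  qed
  show ?thesis
  proof (induction p)
    case 0
    show ?case by (rule blinfun_eqI) (simp add: poly_op_0)
  next
    case (pCons a p)
    have "poly_op (pCons a p) T = poly_op (smult a 1 + pCons 0 p) T"
      by simp
    also have "\<dots> = op_scaleC a id_blinfun + (T o\<^sub>L poly_op p T)"
      by (simp only: poly_op_add poly_op_smult poly_op_1 shift)
    finally have *: "poly_op (pCons a p) T = op_scaleC a id_blinfun + (T o\<^sub>L poly_op p T)" .
    have "poly_op (pCons a p * q) T = op_scaleC a (poly_op q T) + (T o\<^sub>L poly_op (p * q) T)"
      by (simp only: mult_pCons_left poly_op_add poly_op_smult shift)
    then show ?case
      unfolding * pCons.IH
      by (intro blinfun_eqI) (simp add: blinfun.add_left op_scaleC.rep_eq)
  qed
qed

lemma operator_subalgebra_generated_algebra: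
  assumes "T \<in> bounded_operators"
  shows "operator_subalgebra (generated_algebra T)"
  unfolding operator_subalgebra_def generated_algebra_def
proof (intro conjI ballI allI)
  show "range (\<lambda>p. poly_op p T) \<subseteq> bounded_operators"
    using bounded_operators_poly_op[OF assms] by blast
  show "0 \<in> range (\<lambda>p. poly_op p T)"
    by (rule range_eqI) (rule poly_op_0[symmetric])
qed (auto simp flip: poly_op_add poly_op_mult[OF assms] poly_op_smult)

section \<open>Weighted shifts and the spectral quantities\<close>

definition bilateral_weighted_shift ::
  "(int \<Rightarrow> 'a::complex_inner) \<Rightarrow> (int \<Rightarrow> complex) \<Rightarrow> ('a \<Rightarrow>\<^sub>L 'a) \<Rightarrow> bool" where
  "bilateral_weighted_shift e w W \<longleftrightarrow>
    W \<in> bounded_operators \<and> orthonormal_basis e \<and>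
    bounded (range w) \<and> (\<forall>n. w n \<noteq> 0) \<and>
    (\<forall>n. blinfun_apply W (e n) = w n *\<^sub>C e (n + 1))"

definition lower_bound :: "('a::complex_inner \<Rightarrow>\<^sub>L 'a) \<Rightarrow> real" where
  "lower_bound T = (INF x\<in>{x. norm x = 1}. norm (blinfun_apply T x))"

definition r1 :: "('a::complex_inner \<Rightarrow>\<^sub>L 'a) \<Rightarrow> real" where
  "r1 T = (SUP n\<in>{1..}. root n (lower_bound (op_power T n)))"

definition r2_minus :: "(int \<Rightarrow> complex) \<Rightarrow> ereal" where
  "r2_minus w = liminf (\<lambda>n. ereal (root n (cmod (\<Prod>k=1..n. w (- int k)))))"

end

theory Submission
  imports Defs
begin

text \<open>
  If \<open>p(W\<^sup>-\<^sup>1)\<close> has norm at most 1, then each of its matrix entries is at most 1 in modulus, so the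
  \<open>n\<close>-th coefficient of \<open>p\<close> is bounded by \<open>\<parallel>W\<^sup>n e\<^sub>j\<parallel>\<close> for every \<open>j\<close>.  The infimum over \<open>j\<close> is
  \<open>m(W\<^sup>n)\<close>, hence at most \<open>r\<^sub>1(W)\<^sup>n\<close>.  On the other hand \<open>\<parallel>W\<^sup>-\<^sup>n e\<^sub>0\<parallel> = 1 / \<bar>w\<^sub>-\<^sub>1 \<cdots> w\<^sub>-\<^sub>n\<bar>\<close> is eventually
  below \<open>r\<^sup>-\<^sup>n\<close> for some \<open>r > r\<^sub>1(W)\<close>, so the vectors \<open>p(W\<^sup>-\<^sup>1) e\<^sub>0\<close> are dominated termwise by a convergent
  series and form a precompact set.  The vectors with precompact orbit form a closed subspace that is
  invariant under \<open>W\<close> and \<open>W\<^sup>-\<^sup>1\<close>, hence the whole space, and Tychonoff's theorem turns pointwise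
  precompactness into precompactness in the strong operator topology.
\<close>

section \<open>Precompact sets\<close>

lemma compact_closure_subset:
  fixes A :: "'a::t2_space set"
  assumes "compact K" "A \<subseteq> K"
  shows "compact (closure A)"
proof -
  have "closure A \<subseteq> K"
    using assms by (simp add: closure_minimal compact_imp_closed)
  then show ?thesis
    using compact_Int_closed[OF assms(1), of "closure A"] by (simp add: Int_absorb1)
qed

text \<open>In a complete space it is enough to find finite nets. A net for an approximating compact
  \<open>K\<close> serves for \<open>closure A\<close>: one third of \<epsilon> is spent from the
  net to \<open>K\<close>, one from \<open>K\<close> to \<open>A\<close>, one from \<open>A\<close>
  to its closure.\<close>

lemma compact_closure_approx:
  fixes A :: "'a::complete_space set"
  assumes approx: "\<And>\<epsilon>. \<epsilon> > 0 \<Longrightarrow> \<exists>K. compact K \<and> (\<forall>a\<in>A. \<exists>k\<in>K. dist a k < \<epsilon>)"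
  shows "compact (closure A)"
  unfolding compact_eq_totally_bounded
proof (intro conjI allI impI)
  show "complete (closure A)"
    by (simp add: complete_eq_closed)
  fix \<epsilon> :: real assume "\<epsilon> > 0"
  then have "\<epsilon> / 3 > 0" by simp
  from approx[OF this] obtain K where K: "compact K" "\<forall>a\<in>A. \<exists>k\<in>K. dist a k < \<epsilon> / 3"
    by blast
  obtain F where F: "finite F" "K \<subseteq> (\<Union>x\<in>F. ball x (\<epsilon> / 3))"
    using K(1) \<open>\<epsilon> / 3 > 0\<close> unfolding compact_eq_totally_bounded by blast
  have "closure A \<subseteq> (\<Union>x\<in>F. ball x \<epsilon>)"
  proof
    fix b assume "b \<in> closure A"
    then obtain a where a: "a \<in> A" "dist a b < \<epsilon> / 3"
      using \<open>\<epsilon> / 3 > 0\<close> unfolding closure_approachable by blast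
    with K(2) obtain k where k: "k \<in> K" "dist a k < \<epsilon> / 3" by blast
    with F(2) obtain x where x: "x \<in> F" "dist x k < \<epsilon> / 3" by auto
    have "dist x b \<le> dist x k + (dist a k + dist a b)"
      by (smt (verit) dist_commute dist_triangle)
    then have "dist x b < \<epsilon>"
      using a(2) k(2) x(2) by simp
    then show "b \<in> (\<Union>x\<in>F. ball x \<epsilon>)"
      using x(1) by auto
  qed
  then show "\<exists>F. finite F \<and> closure A \<subseteq> (\<Union>x\<in>F. ball x \<epsilon>)"
    using F(1) by blast
qed

lemma bounded_linear_scaleC_left: "bounded_linear (\<lambda>z :: complex. z *\<^sub>C (x :: 'a::complex_inner))"
  by (rule bounded_linear_intro[where K = "norm x"])
    (simp_all add: scaleC_add_left scaleR_eq_scaleC scaleC_scaleC norm_scaleC scaleR_conv_of_real)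

lemma bounded_linear_scaleC_right: "bounded_linear (\<lambda>x :: 'a::complex_inner. c *\<^sub>C x)"
  by (rule bounded_linear_intro[where K = "cmod c"])
    (simp_all only: scaleC_add_right scaleR_eq_scaleC scaleC_scaleC norm_scaleC mult.commute order_refl)

text \<open>Each summand ranges over the image of a closed disc, and a sum of two compact sets is
  compact. Bounding all coefficients, not just the first \<open>n\<close>, keeps the constraint the
  same throughout the induction.\<close>

lemma compact_scaleC_sums:
  fixes v :: "nat \<Rightarrow> 'a::complex_inner"
  shows "compact {\<Sum>i<n. c i *\<^sub>C v i | c. \<forall>i. cmod (c i) \<le> M i}"
proof (induction n)
  case 0
  \<comment> \<open>Only an inclusion in \<open>{0}\<close> holds in general: the set is empty if
    some \<open>M i\<close> is negative.\<close>
  show ?case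
    by (rule finite_imp_compact) (rule finite_subset[of _ "{0}"], auto)
next
  case (Suc n)
  let ?S = "\<lambda>n. {\<Sum>i<n. c i *\<^sub>C v i | c. \<forall>i. cmod (c i) \<le> M i}"
  let ?D = "(\<lambda>z. z *\<^sub>C v n) ` cball 0 (M n)"
  have "compact ?D"
    by (intro compact_continuous_image linear_continuous_on bounded_linear_scaleC_left compact_cball)
  with Suc have "compact {x + y | x y. x \<in> ?S n \<and> y \<in> ?D}"
    by (rule compact_sums)
  also have "{x + y | x y. x \<in> ?S n \<and> y \<in> ?D} = ?S (Suc n)" (is "?L = ?R")
  proof
    show "?L \<subseteq> ?R"
    proof clarify
      fix c and z :: complex assume "\<forall>i. cmod (c i) \<le> M i" "z \<in> cball 0 (M n)"
      then show "\<exists>c'. (\<Sum>i<n. c i *\<^sub>C v i) + z *\<^sub>C v n = (\<Sum>i<Suc n. c' i *\<^sub>C v i) \<and>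
          (\<forall>i. cmod (c' i) \<le> M i)"
        by (intro exI[of _ "c(n := z)"]) auto
    qed
    show "?R \<subseteq> ?L"
      by fastforce
  qed
  finally show ?case .
qed

text \<open>A compactness form of the Weierstrass M-test: the tails beyond some \<open>N\<close> are
  small uniformly over \<open>A\<close>, so truncation at \<open>N\<close> moves each element by
  less than \<epsilon> into a compact set of sums of fixed length.\<close>

lemma compact_closure_scaleC_sums:
  fixes v :: "nat \<Rightarrow> 'a::complex_hilbert_space"
  assumes summ: "summable (\<lambda>i. M i * norm (v i))"
    and A: "\<And>a. a \<in> A \<Longrightarrow> \<exists>n c. a = (\<Sum>i<n. c i *\<^sub>C v i) \<and> (\<forall>i. cmod (c i) \<le> M i)"
  shows "compact (closure A)"
proof (rule compact_closure_approx)
  fix \<epsilon> :: real assume "\<epsilon> > 0"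
  with summ obtain N where N: "\<And>m n. m \<ge> N \<Longrightarrow> norm (\<Sum>i=m..<n. M i * norm (v i)) < \<epsilon>"
    unfolding summable_Cauchy by blast
  let ?K = "{\<Sum>i<N. c i *\<^sub>C v i | c. \<forall>i. cmod (c i) \<le> M i}"
  have "\<exists>k\<in>?K. dist a k < \<epsilon>" if a: "a \<in> A" for a
  proof -
    obtain n c where c: "a = (\<Sum>i<n. c i *\<^sub>C v i)" "\<forall>i. cmod (c i) \<le> M i"
      using A[OF a] by blast
    have M0: "0 \<le> M i" for i
      using c(2) norm_ge_zero order_trans by blast
    \<comment> \<open>Padding with zeros allows a cut at \<open>N\<close> whichever of
      \<open>n\<close> and \<open>N\<close> is larger; zero is admissible because the bounds are
      nonnegative.\<close>
    define d where "d i = (if i < n then c i else 0)" for i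
    have "\<forall>i. cmod (d i) \<le> M i"
      using c(2) M0 by (simp add: d_def)
    have "a = (\<Sum>i<max N n. d i *\<^sub>C v i)"
      unfolding c(1) by (rule sum.mono_neutral_cong_left) (auto simp: d_def)
    also have "{..<max N n} = {..<N} \<union> {N..<n}"
      by auto
    also have "(\<Sum>i\<in>\<dots>. d i *\<^sub>C v i) = (\<Sum>i<N. d i *\<^sub>C v i) + (\<Sum>i=N..<n. d i *\<^sub>C v i)"
      by (rule sum.union_disjoint) auto
    finally have "dist a (\<Sum>i<N. d i *\<^sub>C v i) = norm (\<Sum>i=N..<n. d i *\<^sub>C v i)"
      by (simp add: dist_norm)
    also have "\<dots> \<le> (\<Sum>i=N..<n. M i * norm (v i))"
      using \<open>\<forall>i. cmod (d i) \<le> M i\<close>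
      by (intro sum_norm_le) (simp add: norm_scaleC mult_right_mono)
    also have "\<dots> < \<epsilon>"
      using N[of N n] by simp
    finally show ?thesis
      using \<open>\<forall>i. cmod (d i) \<le> M i\<close> by blast
  qed
  then show "\<exists>K. compact K \<and> (\<forall>a\<in>A. \<exists>k\<in>K. dist a k < \<epsilon>)"
    using compact_scaleC_sums by blast
qed

section \<open>Precompactness in the strong operator topology\<close>

text \<open>Two distinct operators are separated by evaluation at a vector where they differ. This
  later makes a compact set of operators closed, so that it contains the closure of any of its
  subsets.\<close>

lemma Hausdorff_strong_operator_topology:
  "Hausdorff_space (strong_operator_topology :: ('a::real_normed_vector \<Rightarrow>\<^sub>L 'b::real_normed_vector) topology)"
  unfolding Hausdorff_space_def
proof (intro allI impI, elim conjE)
  fix S T :: "'a \<Rightarrow>\<^sub>L 'b"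
  assume "S \<noteq> T"
  then obtain x where "S x \<noteq> T x"
    using blinfun_eqI by blast
  then obtain U V where UV: "open U" "open V" "S x \<in> U" "T x \<in> V" "U \<inter> V = {}"
    using hausdorff[OF \<open>S x \<noteq> T x\<close>] by blast
  have "openin strong_operator_topology {f :: 'a \<Rightarrow>\<^sub>L 'b. f x \<in> Y}" if "open Y" for Y
    using strong_operator_topology_basis[of "{x}" "\<lambda>_. Y" "\<lambda>x. x"] that by simp
  with UV show "\<exists>U V. openin strong_operator_topology U \<and> openin strong_operator_topology V \<and>
      S \<in> U \<and> T \<in> V \<and> disjnt U V"
    by (intro exI[of _ "{f. blinfun_apply f x \<in> U}"] exI[of _ "{f. blinfun_apply f x \<in> V}"])
      (auto simp: disjnt_def)
qed

text \<open>The strong operator topology is that of pointwise convergence, so \<open>B\<close> can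
  be viewed inside the product of its orbit closures, which is compact by Tychonoff. Linearity and
  contractivity survive pointwise limits, so the limits are again operators.\<close>

lemma compactin_SOT_closure:
  fixes B :: "('a::complex_inner \<Rightarrow>\<^sub>L 'a) set"
  assumes B: "B \<subseteq> bounded_operators" "\<And>T. T \<in> B \<Longrightarrow> norm T \<le> 1"
    and orbit: "\<And>x. compact (closure ((\<lambda>T. blinfun_apply T x) ` B))"
  defines "SOT \<equiv> subtopology strong_operator_topology bounded_operators"
  shows "compactin SOT (SOT closure_of B)"
proof -
  define P where "P = (\<Pi>\<^sub>E x\<in>UNIV. closure ((\<lambda>T. blinfun_apply T x) ` B))"
  \<comment> \<open>The norm condition is what forces pointwise limits to be bounded; it is
    available because \<open>B\<close> lies in the unit ball.\<close>
  define L where "L = {f :: 'a \<Rightarrow> 'a. (\<forall>x y. f (x + y) = f x + f y) \<and>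
    (\<forall>c x. f (c *\<^sub>C x) = c *\<^sub>C f x) \<and> (\<forall>x. norm (f x) \<le> norm x)}"
  have "compact P"
  proof -
    have "compactin (product_topology (\<lambda>x :: 'a. euclidean :: 'a topology) UNIV) P"
      unfolding P_def compactin_PiE using orbit by simp
    then show ?thesis
      by (simp add: euclidean_product_topology)
  qed
  moreover have "closed L"
  proof -
    have ev: "continuous_on UNIV (\<lambda>f :: 'a \<Rightarrow> 'a. f x)" for x
      by (rule continuous_on_product_coordinates)
    have "continuous_on UNIV (\<lambda>f :: 'a \<Rightarrow> 'a. c *\<^sub>C f x)" for c x
      by (rule bounded_linear.continuous_on[OF bounded_linear_scaleC_right ev])
    then have "closed {f :: 'a \<Rightarrow> 'a. \<forall>c x. f (c *\<^sub>C x) = c *\<^sub>C f x}"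
      by (intro closed_Collect_all closed_Collect_eq ev)
    moreover have "closed {f :: 'a \<Rightarrow> 'a. \<forall>x y. f (x + y) = f x + f y}"
      by (intro closed_Collect_all closed_Collect_eq continuous_on_add ev)
    moreover have "closed {f :: 'a \<Rightarrow> 'a. \<forall>x. norm (f x) \<le> norm x}"
      by (intro closed_Collect_all closed_Collect_le continuous_on_norm continuous_on_const ev)
    ultimately show ?thesis
      unfolding L_def by (intro closed_Collect_conj)
  qed
  ultimately have "compact (P \<inter> L)"
    by (rule compact_Int_closed)
  have lin: "bounded_linear f" if "f \<in> L" for f
    using that unfolding L_def
    by (intro bounded_linear_intro[where K = 1]) (auto simp: scaleR_eq_scaleC)
  have apply_Blinfun: "blinfun_apply (Blinfun f) = f" if "f \<in> L" for f
    using bounded_linear_Blinfun_apply[OF lin[OF that]] .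
  \<comment> \<open>\<open>Blinfun\<close> inverts \<open>blinfun_apply\<close> on bounded linear
    maps, hence on \<open>L\<close>; there each coordinate of the map is just an evaluation.\<close>
  have "continuous_map (top_of_set (P \<inter> L)) strong_operator_topology Blinfun"
    unfolding continuous_on_strong_operator_topo_iff_coordinatewise
  proof
    fix x
    have "continuous_on (P \<inter> L) (\<lambda>f. blinfun_apply (Blinfun f) x) \<longleftrightarrow> continuous_on (P \<inter> L) (\<lambda>f. f x)"
      by (rule continuous_on_cong) (auto simp: apply_Blinfun)
    moreover have "continuous_on (P \<inter> L) (\<lambda>f. f x)"
      by (rule continuous_on_subset[OF continuous_on_product_coordinates]) simp
    ultimately show "continuous_map (top_of_set (P \<inter> L)) euclidean (\<lambda>f. blinfun_apply (Blinfun f) x)"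
      by simp
  qed
  moreover have "compactin (top_of_set (P \<inter> L)) (P \<inter> L)"
    using \<open>compact (P \<inter> L)\<close> by (simp add: compactin_subtopology)
  ultimately have "compactin strong_operator_topology (Blinfun ` (P \<inter> L))"
    by (rule image_compactin[rotated])
  moreover have "Blinfun ` (P \<inter> L) \<subseteq> bounded_operators"
    by (auto simp: bounded_operators_def apply_Blinfun) (simp add: L_def)
  ultimately have cpt: "compactin SOT (Blinfun ` (P \<inter> L))"
    by (simp add: SOT_def compactin_subtopology)
  have "B \<subseteq> Blinfun ` (P \<inter> L)"
  proof
    fix T assume T: "T \<in> B"
    then have "T \<in> bounded_operators" "norm T \<le> 1"
      using B by auto
    have "norm (T x) \<le> norm x" for x
      using norm_blinfun[of T x] \<open>norm T \<le> 1\<close>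
      by (meson mult_left_le_one_le norm_ge_zero order_trans)
    then have "blinfun_apply T \<in> L"
      using \<open>T \<in> bounded_operators\<close> by (simp add: L_def bounded_operators_def blinfun.add_right)
    moreover have "blinfun_apply T \<in> P"
      using T closure_subset by (fastforce simp: P_def)
    ultimately show "T \<in> Blinfun ` (P \<inter> L)"
      by (metis IntI blinfun_apply_inverse image_eqI)
  qed
  moreover have "closedin SOT (Blinfun ` (P \<inter> L))"
    using cpt Hausdorff_strong_operator_topology unfolding SOT_def
    by (intro compactin_imp_closedin Hausdorff_space_subtopology)
  ultimately have "SOT closure_of B \<subseteq> Blinfun ` (P \<inter> L)"
    by (rule closure_of_minimal)
  then show ?thesis
    using closed_compactin[OF cpt] by simp
qed

section \<open>Vectors with precompact orbit\<close>

definition precompact_orbit_vectors :: "('a::complex_inner \<Rightarrow>\<^sub>L 'a) set \<Rightarrow> 'a set" where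
  "precompact_orbit_vectors B = {x. compact (closure ((\<lambda>T. blinfun_apply T x) ` B))}"

text \<open>By commutation the orbit of \<open>A x\<close> is the image of the orbit of
  \<open>x\<close> under the continuous map \<open>A\<close>. It is applied to scalar multiples of
  the identity, to the shift and to its inverse.\<close>

lemma precompact_orbit_vectors_image:
  assumes "x \<in> precompact_orbit_vectors B"
    and "\<And>T. T \<in> B \<Longrightarrow> blinfun_apply T (blinfun_apply A x) = blinfun_apply A (blinfun_apply T x)"
  shows "A x \<in> precompact_orbit_vectors B"
proof -
  have "(\<lambda>T. blinfun_apply T (A x)) ` B \<subseteq> A ` closure ((\<lambda>T. blinfun_apply T x) ` B)"
    using assms(2) closure_subset by fastforce
  moreover have "compact (A ` closure ((\<lambda>T. blinfun_apply T x) ` B))"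
    using assms(1) unfolding precompact_orbit_vectors_def
    by (intro compact_continuous_image linear_continuous_on blinfun.bounded_linear_right) simp
  ultimately show ?thesis
    unfolding precompact_orbit_vectors_def by (simp add: compact_closure_subset)
qed

lemma subspace_precompact_orbit_vectors:
  assumes "B \<subseteq> bounded_operators"
  shows "complex_vector.subspace (precompact_orbit_vectors B)"
proof (rule complex_vector.subspaceI)
  have "(\<lambda>T. blinfun_apply T 0) ` B \<subseteq> {0}"
    by auto
  then show "0 \<in> precompact_orbit_vectors B"
    unfolding precompact_orbit_vectors_def using compact_closure_subset[of "{0}"] by simp
next
  fix x y assume "x \<in> precompact_orbit_vectors B" "y \<in> precompact_orbit_vectors B"
  then have "compact {u + v | u v. u \<in> closure ((\<lambda>T. blinfun_apply T x) ` B) \<and>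
      v \<in> closure ((\<lambda>T. blinfun_apply T y) ` B)}"
    unfolding precompact_orbit_vectors_def by (intro compact_sums) auto
  moreover have "(\<lambda>T. blinfun_apply T (x + y)) ` B \<subseteq>
      {u + v | u v. u \<in> closure ((\<lambda>T. blinfun_apply T x) ` B) \<and>
      v \<in> closure ((\<lambda>T. blinfun_apply T y) ` B)}"
    using closure_subset[of "(\<lambda>T. blinfun_apply T x) ` B"] closure_subset[of "(\<lambda>T. blinfun_apply T y) ` B"]
    by (auto simp: blinfun.add_right image_subset_iff)
  ultimately show "x + y \<in> precompact_orbit_vectors B"
    unfolding precompact_orbit_vectors_def by (simp add: compact_closure_subset)
next
  fix c x assume "x \<in> precompact_orbit_vectors B"
  moreover have "T (c *\<^sub>C x) = c *\<^sub>C T x" if "T \<in> B" for T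
    using that assms by (auto simp: bounded_operators_def)
  ultimately show "c *\<^sub>C x \<in> precompact_orbit_vectors B"
    using precompact_orbit_vectors_image[of x B "op_scaleC c id_blinfun"]
    by (simp add: op_scaleC.rep_eq)
qed

text \<open>Contractions do not increase distances, so the orbit of a nearby vector \<open>y\<close>
  approximates that of \<open>x\<close> uniformly over \<open>B\<close>.\<close>

lemma closed_precompact_orbit_vectors:
  fixes B :: "('a::complex_hilbert_space \<Rightarrow>\<^sub>L 'a) set"
  assumes B: "\<And>T. T \<in> B \<Longrightarrow> norm T \<le> 1"
  shows "closed (precompact_orbit_vectors B)"
proof -
  have "x \<in> precompact_orbit_vectors B" if x: "x \<in> closure (precompact_orbit_vectors B)" for x
    unfolding precompact_orbit_vectors_def mem_Collect_eq
  proof (rule compact_closure_approx)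
    fix \<epsilon> :: real assume "\<epsilon> > 0"
    with x obtain y where y: "y \<in> precompact_orbit_vectors B" "dist y x < \<epsilon>"
      unfolding closure_approachable by blast
    let ?K = "closure ((\<lambda>T. blinfun_apply T y) ` B)"
    have "dist (T x) (T y) < \<epsilon>" if "T \<in> B" for T
    proof -
      have "dist (T x) (T y) \<le> norm T * dist x y"
        by (metis blinfun.diff_right dist_norm norm_blinfun)
      also have "\<dots> \<le> dist x y"
        using B[OF that] by (simp add: mult_left_le_one_le)
      finally show ?thesis
        using y(2) by (simp add: dist_commute)
    qed
    moreover have "T y \<in> ?K" if "T \<in> B" for T
      using that closure_subset by fastforce
    ultimately have "\<forall>a\<in>(\<lambda>T. blinfun_apply T x) ` B. \<exists>k\<in>?K. dist a k < \<epsilon>"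
      by blast
    moreover have "compact ?K"
      using y(1) by (simp add: precompact_orbit_vectors_def)
    ultimately show "\<exists>K. compact K \<and> (\<forall>a\<in>(\<lambda>T. blinfun_apply T x) ` B. \<exists>k\<in>K. dist a k < \<epsilon>)"
      by blast
  qed
  then show ?thesis
    using closure_subset_eq by blast
qed

section \<open>Weighted shifts\<close>

lemma cmod_cinner_le: "cmod (cinner x y) \<le> norm x * norm (y :: 'a::complex_inner)"
proof (cases "cinner x y = 0")
  case False
  let ?z = "cinner x y"
  \<comment> \<open>The unimodular factor that rotates the inner product onto its modulus, reducing
    the claim to the real Cauchy-Schwarz inequality.\<close>
  define u where "u = cnj ?z / complex_of_real (cmod ?z)"
  have "u * ?z = complex_of_real (cmod ?z)"
    using False by (simp add: u_def field_simps flip: complex_norm_square power2_eq_square)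
  then have "cmod ?z = inner (u *\<^sub>C x) y"
    by (simp add: inner_eq_Re_cinner cinner_scaleC_left)
  also have "\<dots> \<le> norm (u *\<^sub>C x) * norm y"
    by (rule norm_cauchy_schwarz)
  also have "cmod u = 1"
    using False by (simp add: u_def norm_divide)
  then have "norm (u *\<^sub>C x) = norm x"
    by (simp add: norm_scaleC)
  finally show ?thesis .
qed simp

lemma cinner_sum_left:
  "cinner (\<Sum>i\<in>I. f i) y = (\<Sum>i\<in>I. cinner (f i) (y :: 'a::complex_inner))"
proof -
  have "cinner 0 y = 0"
    using cinner_add_left[of 0 0 y] by simp
  then show ?thesis
    by (induction I rule: infinite_finite_induct) (simp_all add: cinner_add_left)
qed

lemma op_power_commute:
  assumes "\<And>x. blinfun_apply T (blinfun_apply A x) = blinfun_apply A (blinfun_apply T x)"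
  shows "op_power T n (A x) = A (op_power T n x)"
  by (induction n) (simp_all add: assms)

lemma op_power_scaleC:
  assumes "T \<in> bounded_operators"
  shows "op_power T n (c *\<^sub>C x) = c *\<^sub>C op_power T n x"
  using assms by (induction n) (auto simp: bounded_operators_def)

lemma norm_op_power_apply_le: "norm (op_power T n x) \<le> norm T ^ n * norm x"
proof (induction n)
  case (Suc n)
  have "norm (T (op_power T n x)) \<le> norm T * norm (op_power T n x)"
    by (rule norm_blinfun)
  also have "\<dots> \<le> norm T * (norm T ^ n * norm x)"
    by (rule mult_left_mono[OF Suc]) simp
  finally show ?case
    by (simp add: mult.assoc)
qed simp

section \<open>Lower bounds of powers and \<open>r1\<close>\<close>

lemma lower_bound_le:
  assumes "norm x = 1"
  shows "lower_bound T \<le> norm (blinfun_apply T x)"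
  unfolding lower_bound_def using assms
  by (intro cINF_lower) (auto intro: bdd_belowI[of _ 0])

text \<open>The unit vector \<open>x\<close> makes the set under the infimum nonempty.\<close>

lemma lower_bound_ge:
  fixes T :: "'a::complex_inner \<Rightarrow>\<^sub>L 'a"
  assumes "norm (x :: 'a) = 1" and "\<And>y. b * norm y \<le> norm (blinfun_apply T y)"
  shows "b \<le> lower_bound T"
  unfolding lower_bound_def
proof (rule cINF_greatest)
  show "b \<le> norm (blinfun_apply T y)" if "y \<in> {x. norm x = 1}" for y
    using assms(2)[of y] that by simp
qed (use assms(1) in blast)

lemma lower_bound_op_power_le:
  fixes T :: "'a::complex_inner \<Rightarrow>\<^sub>L 'a"
  assumes x: "norm (x :: 'a) = 1"
  shows "0 \<le> r1 T" and "lower_bound (op_power T n) \<le> r1 T ^ n"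
proof -
  have nonneg: "0 \<le> lower_bound (op_power T n)" for n
    by (rule lower_bound_ge[OF x]) simp
  have le: "lower_bound (op_power T n) \<le> norm T ^ n" for n
    using lower_bound_le[OF x, of "op_power T n"] norm_op_power_apply_le[of T n x] x by simp
  have "root n (lower_bound (op_power T n)) \<le> norm T" if "n \<ge> 1" for n
  proof -
    have "root n (lower_bound (op_power T n)) \<le> root n (norm T ^ n)"
      using le that by simp
    then show ?thesis
      using that by (simp add: real_root_power_cancel)
  qed
  \<comment> \<open>The real supremum \<open>r1 T\<close> dominates its members once they are known
    to be bounded, here by \<open>norm T\<close>.\<close>
  then have "bdd_above ((\<lambda>n. root n (lower_bound (op_power T n))) ` {1..})"
    by (auto intro: bdd_aboveI[of _ "norm T"])
  then have root_le: "root n (lower_bound (op_power T n)) \<le> r1 T" if "n \<ge> 1" for n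
    unfolding r1_def using that by (intro cSUP_upper) auto
  show "0 \<le> r1 T"
    using root_le[of 1] nonneg[of 1] by simp
  show "lower_bound (op_power T n) \<le> r1 T ^ n"
  \<comment> \<open>The supremum starts at exponent 1, so exponent 0 is checked directly: the lower
    bound of the identity is at most 1.\<close>
  proof (cases "n = 0")
    case True
    then show ?thesis
      using le[of 0] by simp
  next
    case False
    then have "lower_bound (op_power T n) = root n (lower_bound (op_power T n)) ^ n"
      using nonneg by simp
    also have "\<dots> \<le> r1 T ^ n"
      using root_le False nonneg by (intro power_mono) auto
    finally show ?thesis .
  qed
qed

text \<open>The coefficient of \<open>op_power W n (e j)\<close> along
  \<open>e (j + int n)\<close>.\<close>

definition shift_weight :: "(int \<Rightarrow> complex) \<Rightarrow> nat \<Rightarrow> int \<Rightarrow> complex" where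
  "shift_weight w n j = (\<Prod>k<n. w (j + int k))"

text \<open>Reversing the order of the factors identifies the weight governing the
  \<open>n\<close>-th inverse power at \<open>e 0\<close> with the product in
  \<open>r2_minus\<close>.\<close>

lemma shift_weight_backward: "shift_weight w n (- int n) = (\<Prod>k=1..n. w (- int k))"
  unfolding shift_weight_def
  by (rule prod.reindex_bij_witness[of _ "\<lambda>k. n - k" "\<lambda>k. n - k"]) (auto simp: of_nat_diff)

text \<open>The inverse is an arbitrary two-sided inverse \<open>S\<close> here, which keeps the
  definite description in \<open>inverse_op\<close> out of the argument.\<close>

locale invertible_shift =
  fixes W S :: "'a::complex_hilbert_space \<Rightarrow>\<^sub>L 'a"
    and e :: "int \<Rightarrow> 'a"
    and w :: "int \<Rightarrow> complex"
  assumes shift: "bilateral_weighted_shift e w W"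
    and S: "S \<in> bounded_operators"
    and WS: "W o\<^sub>L S = id_blinfun" and SW: "S o\<^sub>L W = id_blinfun"
begin

lemma W: "W \<in> bounded_operators"
  and cinner_e: "cinner (e i) (e j) = (if i = j then 1 else 0)"
  and dense_e: "closure (complex_vector.span (range e)) = UNIV"
  and w_nonzero: "w j \<noteq> 0"
  and W_e: "W (e j) = w j *\<^sub>C e (j + 1)"
  using shift by (auto simp: bilateral_weighted_shift_def orthonormal_basis_def)

lemma WS_apply: "W (S x) = x" and SW_apply: "S (W x) = x"
  using WS SW by (metis blinfun_apply_blinfun_compose blinfun_apply_id_blinfun)+

lemma norm_e: "norm (e j) = 1"
  by (simp add: norm_eq_sqrt_inner inner_eq_Re_cinner cinner_e)

lemma shift_weight_nonzero: "shift_weight w n j \<noteq> 0"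
  by (simp add: shift_weight_def w_nonzero)

lemma op_power_W_e: "op_power W n (e j) = shift_weight w n j *\<^sub>C e (j + int n)"
proof (induction n)
  case (Suc n)
  then have "op_power W (Suc n) (e j) = shift_weight w n j *\<^sub>C W (e (j + int n))"
    using W by (simp add: bounded_operators_def)
  then show ?case
    by (simp add: W_e scaleC_scaleC shift_weight_def ac_simps)
qed (simp add: shift_weight_def scaleC_one)

lemma op_power_S_W: "op_power S n (op_power W n x) = x"
  \<comment> \<open>\<open>S\<close> and \<open>W\<close> commute, so the outermost \<open>W\<close>
    moves past the power of \<open>S\<close> and cancels.\<close>
  by (induction n) (simp_all add: op_power_commute[of S W] WS_apply SW_apply)

lemma op_power_S_e: "op_power S n (e j) = inverse (shift_weight w n (j - int n)) *\<^sub>C e (j - int n)"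
proof -
  have "e (j - int n) = op_power S n (shift_weight w n (j - int n) *\<^sub>C e j)"
    using op_power_S_W[of n "e (j - int n)"] by (simp add: op_power_W_e)
  then show ?thesis
    by (simp add: op_power_scaleC[OF S] scaleC_scaleC shift_weight_nonzero scaleC_one)
qed

text \<open>A power of \<open>W\<close> sends the orthonormal basis to orthogonal vectors of norm at
  least \<open>b\<close>. Pythagoras gives the inequality for finite combinations, and it passes to
  the closure.\<close>

lemma norm_op_power_W_ge:
  assumes b: "0 \<le> b" "\<And>j. b \<le> cmod (shift_weight w n j)"
  shows "b * norm x \<le> norm (op_power W n x)"
proof -
  let ?C = "{x. b * norm x \<le> norm (op_power W n x)}"
  have "x \<in> ?C" if x: "x \<in> complex_vector.span (range e)" for x
  proof -
    obtain t r where t: "finite t" "t \<subseteq> range e" "x = (\<Sum>a\<in>t. r a *\<^sub>C a)"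
      using x unfolding complex_vector.span_explicit by blast
    \<comment> \<open>Injectivity turns a combination of basis vectors into a sum over integer
      indices.\<close>
    have "inj e"
      by (rule injI) (metis cinner_e zero_neq_one)
    obtain F where F: "finite F" "t = e ` F"
      using t by (metis finite_subset_image)
    define c where "c j = r (e j)" for j
    have x: "x = (\<Sum>j\<in>F. c j *\<^sub>C e j)"
      unfolding t(3) F(2) c_def
      using \<open>inj e\<close> by (subst sum.reindex) (auto intro: inj_on_subset)
    have Wx: "op_power W n x = (\<Sum>j\<in>F. (c j * shift_weight w n j) *\<^sub>C e (j + int n))"
      unfolding x by (simp add: blinfun.sum_right op_power_scaleC[OF W] op_power_W_e scaleC_scaleC)
    \<comment> \<open>Used twice: with \<open>k = 0\<close> for \<open>x\<close> and with
      \<open>k = int n\<close> for its image.\<close>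
    have orth: "pairwise (\<lambda>i j. orthogonal (d i *\<^sub>C e (i + k)) (d j *\<^sub>C e (j + k))) F" for d k
    proof (rule pairwiseI)
      fix i j :: int assume "i \<noteq> j"
      have "cinner (d i *\<^sub>C e (i + k)) (d j *\<^sub>C e (j + k)) = d i * cnj (d j * cinner (e (j + k)) (e (i + k)))"
        by (metis cinner_scaleC_left cinner_commute)
      then show "orthogonal (d i *\<^sub>C e (i + k)) (d j *\<^sub>C e (j + k))"
        using \<open>i \<noteq> j\<close> by (simp add: orthogonal_def inner_eq_Re_cinner cinner_e)
    qed
    have "(b * norm x)\<^sup>2 = b\<^sup>2 * (\<Sum>j\<in>F. (cmod (c j))\<^sup>2)"
      unfolding x power_mult_distrib
      using norm_sum_Pythagorean[OF F(1) orth[of c 0]] by (simp add: norm_scaleC norm_e)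
    also have "\<dots> \<le> (\<Sum>j\<in>F. (cmod (c j * shift_weight w n j))\<^sup>2)"
      unfolding sum_distrib_left norm_mult power_mult_distrib
      by (rule sum_mono) (simp add: b mult.commute[of "b\<^sup>2"] mult_left_mono power_mono)
    also have "\<dots> = (norm (op_power W n x))\<^sup>2"
      unfolding Wx
      using norm_sum_Pythagorean[OF F(1) orth[of "\<lambda>j. c j * shift_weight w n j" "int n"]]
      by (simp add: norm_scaleC norm_e)
    finally show ?thesis
      by (auto dest: power2_le_imp_le)
  qed
  moreover have "closed ?C"
    by (intro closed_Collect_le continuous_intros linear_continuous_on blinfun.bounded_linear_right)
  ultimately have "closure (complex_vector.span (range e)) \<subseteq> ?C"
    by (intro closure_minimal) auto
  then show ?thesis
    using dense_e by auto
qed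

text \<open>The coefficient bound reads off the entry of \<open>p(W\<^sup>-\<^sup>1)\<close> in column \<open>j + n\<close> and row \<open>j\<close>.\<close>

lemma cmod_coeff_le_shift_weight:
  assumes "norm (poly_op p S) \<le> 1"
  shows "cmod (coeff p n) \<le> cmod (shift_weight w n j)"
proof -
  \<comment> \<open>The sum must reach index \<open>n\<close> even if \<open>n\<close> exceeds the
    degree, where the coefficient is zero.\<close>
  let ?N = "max (degree p) n"
  let ?y = "poly_op p S (e (j + int n))"
  have "cinner ?y (e j) = (\<Sum>i\<le>?N. if i = n then coeff p i * inverse (shift_weight w n j) else 0)"
    unfolding poly_op_apply_le[OF max.cobounded1[of "degree p" n]] cinner_sum_left
    by (rule sum.cong) (auto simp: cinner_scaleC_left op_power_S_e cinner_e)
  also have "\<dots> = coeff p n * inverse (shift_weight w n j)"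
    by (subst sum.delta) auto
  finally have "cmod (coeff p n) / cmod (shift_weight w n j) = cmod (cinner ?y (e j))"
    by (simp add: norm_mult norm_inverse divide_inverse)
  also have "\<dots> \<le> norm ?y"
    using cmod_cinner_le[of ?y "e j"] by (simp add: norm_e)
  also have "\<dots> \<le> 1"
    using norm_blinfun[of "poly_op p S" "e (j + int n)"] assms by (simp add: norm_e)
  finally show ?thesis
    using shift_weight_nonzero by (simp add: divide_le_eq)
qed

text \<open>The coefficient does not depend on the column, so its modulus bounds all weights of
  length \<open>n\<close> from below at once and hence is at most the lower bound of the
  \<open>n\<close>-th power of \<open>W\<close>.\<close>

lemma cmod_coeff_le_r1:
  assumes "norm (poly_op p S) \<le> 1"
  shows "cmod (coeff p n) \<le> r1 W ^ n"
proof -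
  have "cmod (coeff p n) \<le> lower_bound (op_power W n)"
    using assms by (intro lower_bound_ge[OF norm_e] norm_op_power_W_ge cmod_coeff_le_shift_weight) auto
  also have "\<dots> \<le> r1 W ^ n"
    by (rule lower_bound_op_power_le[OF norm_e])
  finally show ?thesis .
qed

lemma summable_r1_orbit:
  assumes "ereal (r1 W) < r2_minus w"
  shows "summable (\<lambda>n. r1 W ^ n * norm (op_power S n (e 0)))"
proof -
  \<comment> \<open>A real number strictly in between gives a geometric majorant of ratio
    \<open>r1 W / r < 1\<close>, also when \<open>r2_minus w\<close> is infinite.\<close>
  obtain r where r: "r1 W < r" "ereal r < r2_minus w"
    using ereal_dense2[OF assms] by auto
  have r1: "0 \<le> r1 W"
    by (rule lower_bound_op_power_le[OF norm_e])
  have "\<forall>\<^sub>F n in sequentially. ereal r < ereal (root n (cmod (\<Prod>k=1..n. w (- int k))))"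
    using less_LiminfD[OF r(2)[unfolded r2_minus_def]] .
  then have "\<forall>\<^sub>F n in sequentially.
      norm (r1 W ^ n * norm (op_power S n (e 0))) \<le> (r1 W / r) ^ n"
    \<comment> \<open>A positive exponent is required for the \<open>n\<close>-th power to undo the
      \<open>n\<close>-th root.\<close>
    using eventually_gt_at_top[of 0]
  proof eventually_elim
    case (elim n)
    let ?q = "cmod (shift_weight w n (- int n))"
    have "r ^ n \<le> root n ?q ^ n"
      using elim r r1 by (intro power_mono) (auto simp: shift_weight_backward)
    then have "r ^ n \<le> ?q"
      using elim by simp
    then have "r1 W ^ n * inverse ?q \<le> r1 W ^ n * inverse (r ^ n)"
      using r r1 by (intro mult_left_mono le_imp_inverse_le) auto
    then show ?case
      using r1 by (simp add: op_power_S_e norm_scaleC norm_e norm_inverse divide_inverse power_mult_distrib power_inverse)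
  qed
  moreover have "summable (\<lambda>n. (r1 W / r) ^ n)"
    using r r1 by (intro summable_geometric) simp
  ultimately show ?thesis
    by (rule summable_comparison_test_ev)
qed

lemma poly_op_commute:
  assumes "\<And>x. S (blinfun_apply A x) = blinfun_apply A (S x)" and A: "A \<in> bounded_operators"
  shows "poly_op p S (A x) = A (poly_op p S x)"
  using A by (simp add: poly_op_apply op_power_commute[OF assms(1)] blinfun.sum_right bounded_operators_def)

lemma strongly_compact_S:
  assumes less: "ereal (r1 W) < r2_minus w"
  shows "strongly_compact_op S"
proof -
  define B where "B = {R \<in> generated_algebra S. norm R \<le> 1}"
  have B: "\<exists>p. T = poly_op p S \<and> norm (poly_op p S) \<le> 1" if "T \<in> B" for T
    using that by (auto simp: B_def generated_algebra_def)
  have sub: "B \<subseteq> bounded_operators"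
    using B bounded_operators_poly_op[OF S] by blast
  let ?V = "precompact_orbit_vectors B"
  have V: "complex_vector.subspace ?V"
    by (rule subspace_precompact_orbit_vectors[OF sub])
  \<comment> \<open>The coefficient bounds are the same for all polynomials in the unit ball, so the
    orbit of \<open>e 0\<close> has a common summable majorant.\<close>
  have e0: "e 0 \<in> ?V"
    unfolding precompact_orbit_vectors_def mem_Collect_eq
  proof (rule compact_closure_scaleC_sums[OF summable_r1_orbit[OF less]])
    fix a assume "a \<in> (\<lambda>T. blinfun_apply T (e 0)) ` B"
    then obtain p where p: "a = poly_op p S (e 0)" "norm (poly_op p S) \<le> 1"
      using B by blast
    then show "\<exists>n c. a = (\<Sum>i<n. c i *\<^sub>C op_power S i (e 0)) \<and> (\<forall>i. cmod (c i) \<le> r1 W ^ i)"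
      using cmod_coeff_le_r1
      by (intro exI[of _ "Suc (degree p)"] exI[of _ "coeff p"]) (simp add: poly_op_apply lessThan_Suc_atMost)
  qed
  \<comment> \<open>Every element of \<open>B\<close> is a polynomial in \<open>S\<close>, so it
    commutes with \<open>S\<close> and with its inverse \<open>W\<close>.\<close>
  have V_W: "W x \<in> ?V" and V_S: "S x \<in> ?V" if "x \<in> ?V" for x
    using that B poly_op_commute[OF _ W] poly_op_commute[OF _ S] SW_apply WS_apply
    by (auto intro!: precompact_orbit_vectors_image) (metis)+
  have "e j \<in> ?V" for j
  \<comment> \<open>From \<open>e 0\<close>, the shift reaches the positive indices and
    \<open>S\<close> the negative ones, up to nonzero scalars.\<close>
  proof (induction j rule: int_induct[where k = 0])
    case base
    show ?case by (rule e0)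
  next
    case (step1 i)
    have "e (i + 1) = inverse (w i) *\<^sub>C W (e i)"
      by (simp add: W_e scaleC_scaleC w_nonzero scaleC_one)
    then show ?case
      using step1 V V_W by (simp add: complex_vector.subspace_scale)
  next
    case (step2 i)
    have "w (i - 1) *\<^sub>C S (e i) = S (W (e (i - 1)))"
      using S by (simp add: W_e bounded_operators_def)
    then have "e (i - 1) = w (i - 1) *\<^sub>C S (e i)"
      by (simp add: SW_apply)
    then show ?case
      using step2 V V_S by (simp add: complex_vector.subspace_scale)
  qed
  then have "complex_vector.span (range e) \<subseteq> ?V"
    using V by (intro complex_vector.span_minimal) auto
  moreover have "closed ?V"
    by (rule closed_precompact_orbit_vectors) (simp add: B_def)
  ultimately have "?V = UNIV"
    using dense_e closure_minimal by blast
  then have "compact (closure ((\<lambda>T. blinfun_apply T x) ` B))" for x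
    unfolding precompact_orbit_vectors_def by blast
  then have "compactin (subtopology strong_operator_topology bounded_operators)
      (subtopology strong_operator_topology bounded_operators closure_of B)"
    using sub by (intro compactin_SOT_closure) (auto simp: B_def)
  then show ?thesis
    using S operator_subalgebra_generated_algebra[OF S]
    unfolding strongly_compact_op_def strongly_compact_algebra_def B_def Let_def by blast
qed

end

theorem corollary3:
  fixes W :: "'a::complex_hilbert_space \<Rightarrow>\<^sub>L 'a"
    and e :: "int \<Rightarrow> 'a"
    and w :: "int \<Rightarrow> complex"
  assumes "infinite_dimensional TYPE('a)"
    and "separable_space (euclidean :: 'a topology)"
    and "bilateral_weighted_shift e w W"
    and "invertible_op W"
    and "ereal (r1 W) < r2_minus w"
  shows "strongly_compact_op (inverse_op W)"
proof -
  interpret invertible_shift W "inverse_op W" e w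
    using assms(3) inverse_op[OF assms(4)] by unfold_locales
  show ?thesis
    using assms(5) by (rule strongly_compact_S)
qed

end
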